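(* The discrete binary linear classifier problem is $\max(16,8r)$-split-neighborly. That is: let $d\ge1$ and let $r>0$ be real. Let $\mathcal{X}=\{0,1\}^d$, and for $b\in\mathbb{Z}$ and $w\in\{-1,0,1\}^d$ let $h_{b,w}:\mathcal{X}\to\{0,1\}$ be $h_{b,w}(x)=\mathbf{1}[w\cdot x>b]$. Let $\mathcal{H}$ be a set of functions $h_{b,w}$ with $b\in\mathbb{Z}$, $w\in\{-1,0,1\}^d$, all satisfying $$w^{(+)}-b\le r\,(w^{(-)}+b)-\frac d8,\qquad w^{(-)}+b\le r\,(w^{(+)}-b-1)-\frac d8 .$$ Then $(\mathcal{H},\mathcal{X})$ is $\max(16,8r)$-split-neighborly.
   Context: $w^{(+)}$ and $w^{(-)}$ denote the number of positive and negative components of $w$, respectively. Elements of $\mathcal{H}$ (hypotheses) are regarded as functions $\mathcal{X}\to\{0,1\}$, so distinct hypotheses differ on some test; elements of $\mathcal{X}$ are tests. For a nonempty finite set $V$, $\mathbb{E}_{h\in V}[f(h)]=\frac{1}{|V|}\sum_{h\in V}f(h)$. For tests $x,x'$ let $\Delta(x,x')=\{h\in\mathcal{H}: h(x)=0 \wedge h(x')=1\}$. For $\alpha\in(0,\frac12]$, define a directed graph on $\mathcal{X}$ with a directed edge $(x,x')$ iff for every $V\subseteq\Delta(x,x')$, either $|V|\le 1$ or there exists a test $\hat x\in\mathcal{X}$ with $\mathbb{E}_{h\in V}[h(\hat x)]\in[\alpha,1-\alpha]$. The problem is $\frac1\alpha$-split-neighborly if this graph is strongly connected. *)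

theory Defs
  imports Complex_Main "HOL-Library.FuncSet"
    "Graph_Theory.Digraph_Component" "Graph_Theory.Pair_Digraph"
begin

text \<open>
  A problem is given by a set \<open>H\<close> of hypotheses and a set \<open>X\<close> of tests. Hypotheses are functions
  from \<open>X\<close> to \<open>{0, 1}\<close>; they are taken to be extensional on \<open>X\<close>, so that distinct hypotheses
  differ on some test in \<open>X\<close>.
\<close>

definition mean :: "'h set \<Rightarrow> ('h \<Rightarrow> real) \<Rightarrow> real" where
  "mean V f = (\<Sum>h\<in>V. f h) / real (card V)"

definition Delta :: "('x \<Rightarrow> nat) set \<Rightarrow> 'x \<Rightarrow> 'x \<Rightarrow> ('x \<Rightarrow> nat) set" where
  "Delta H x x' = {h \<in> H. h x = 0 \<and> h x' = 1}"

text \<open>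
  Since \<open>card V = 0\<close> for infinite \<open>V\<close>, the condition below constrains only finite \<open>V\<close>, for which
  the mean is meaningful.
\<close>

definition split_graph ::
    "real \<Rightarrow> ('x \<Rightarrow> nat) set \<Rightarrow> 'x set \<Rightarrow> 'x pair_pre_digraph" where
  "split_graph \<alpha> H X =
    \<lparr> pverts = X,
      parcs = {(x, x'). x \<in> X \<and> x' \<in> X \<and>
        (\<forall>V \<subseteq> Delta H x x'. card V \<le> 1 \<or>
          (\<exists>y\<in>X. mean V (\<lambda>h. real (h y)) \<in> {\<alpha>..1 - \<alpha>}))} \<rparr>"

definition split_neighborly :: "real \<Rightarrow> ('x \<Rightarrow> nat) set \<Rightarrow> 'x set \<Rightarrow> bool" where
  "split_neighborly k H X \<longleftrightarrow>
    (\<exists>\<alpha>\<in>{0<..1/2}. k = 1 / \<alpha> \<and> strongly_connected (with_proj (split_graph \<alpha> H X)))"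

definition binary_tests :: "nat \<Rightarrow> (nat \<Rightarrow> int) set" where
  "binary_tests d = ({..<d} \<rightarrow>\<^sub>E {0, 1})"

definition ternary_weights :: "nat \<Rightarrow> (nat \<Rightarrow> int) set" where
  "ternary_weights d = ({..<d} \<rightarrow>\<^sub>E {-1, 0, 1})"

definition linear_classifier :: "nat \<Rightarrow> int \<Rightarrow> (nat \<Rightarrow> int) \<Rightarrow> (nat \<Rightarrow> int) \<Rightarrow> nat" where
  "linear_classifier d b w =
    restrict (\<lambda>x. if (\<Sum>i<d. w i * x i) > b then 1 else 0) (binary_tests d)"

definition num_pos :: "nat \<Rightarrow> (nat \<Rightarrow> int) \<Rightarrow> nat" where
  "num_pos d w = card {i \<in> {..<d}. w i > 0}"

definition num_neg :: "nat \<Rightarrow> (nat \<Rightarrow> int) \<Rightarrow> nat" where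
  "num_neg d w = card {i \<in> {..<d}. w i < 0}"

end

theory Submission
  imports Defs
begin

text \<open>
  Suppose no test splits \<open>V \<subseteq> \<Delta>(x, x')\<close>, where \<open>x'\<close> is \<open>x\<close> with coordinate \<open>i\<close> flipped. Every
  \<open>h \<in> V\<close> has \<open>x\<close> exactly on its threshold, so flipping a set \<open>S\<close> of coordinates of \<open>x\<close> gives the
  value \<open>1\<close> iff \<open>sum a S > 0\<close>, where \<open>a j \<in> {-1, 0, 1}\<close> is the gain of flipping coordinate \<open>j\<close>.
  Singletons and pairs containing \<open>i\<close> show that almost all of \<open>V\<close> agrees with one sign pattern
  on each coordinate, and averaging the hypotheses on \<open>w\<close> and \<open>b\<close> shows that the numbers \<open>p\<close> and
  \<open>n\<close> of positive and negative coordinates of this pattern satisfy \<open>p \<le> r n\<close> and \<open>n \<le> r (p - 1)\<close>.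
  Every set \<open>S\<close> with equally many positive and negative coordinates has \<open>sum a S \<noteq> 0\<close> for a
  fraction of less than \<open>2 \<alpha>\<close> of \<open>V\<close>. On the other hand, every \<open>a\<close> other than the pattern itself has
  \<open>sum a S \<noteq> 0\<close> with probability at least \<open>3 \<alpha>\<close> for a random such \<open>S\<close> with
  \<open>\<lceil>min (p - 1) n / 2\<rceil>\<close> coordinates of each sign, by a swapping argument. As the elements of \<open>V\<close>
  are distinct, double counting forces \<open>|V| \<le> 3\<close>, and then all of \<open>V\<close> equals the pattern.
\<close>

section \<open>Random subsets that avoid a given sum\<close>

text \<open>An \<open>(m - 1)\<close>-element set avoiding \<open>i\<close> and \<open>j\<close> can
  be extended by either of them. As \<open>f i\<close> and \<open>f j\<close> differ, at most one
  extension sums to \<open>c\<close>, so \<open>g\<close> can choose one that does not. Deleting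
  \<open>i\<close> and \<open>j\<close> recovers the set, hence \<open>g\<close> is
  injective.\<close>

lemma card_sum_nonzero_swap:
  fixes f :: "'i \<Rightarrow> int"
  assumes fin: "finite Q" and ij: "i \<in> Q" "j \<in> Q" and ne: "f i \<noteq> f j" and "m \<ge> 1"
  shows "(card Q - 2) choose (m - 1) \<le> card {A. A \<subseteq> Q \<and> card A = m \<and> sum f A \<noteq> c}"
proof -
  define P where "P = {A. A \<subseteq> Q - {i, j} \<and> card A = m - 1}"
  define g where "g A = (if sum f (insert i A) \<noteq> c then insert i A else insert j A)" for A
  have inj: "inj_on g P"
  proof (rule inj_on_inverseI[where g = "\<lambda>A. A - {i, j}"])
    show "g A - {i, j} = A" if "A \<in> P" for A
      using that by (auto simp: P_def g_def)
  qed
  have sub: "g ` P \<subseteq> {A. A \<subseteq> Q \<and> card A = m \<and> sum f A \<noteq> c}"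
  proof safe
    fix A assume "A \<in> P"
    then have A: "A \<subseteq> Q" "i \<notin> A" "j \<notin> A" "card A = m - 1" and finA: "finite A"
      using fin by (auto simp: P_def dest: finite_subset)
    show "x \<in> Q" if "x \<in> g A" for x
      using that A ij by (auto simp: g_def split: if_splits)
    show "card (g A) = m"
      using A finA \<open>m \<ge> 1\<close> by (auto simp: g_def)
    assume "c = sum f (g A)"
    then show False
      using A finA ne by (auto simp: g_def split: if_splits)
  qed
  have "card (Q - {i, j}) = card Q - 2"
    using fin ij ne by (subst card_Diff_subset) (auto simp: card_insert_if)
  then have "(card Q - 2) choose (m - 1) = card P"
    unfolding P_def using fin by (simp add: n_subsets)
  also have "\<dots> = card (g ` P)"
    using inj by (simp add: card_image)
  also have "\<dots> \<le> card {A. A \<subseteq> Q \<and> card A = m \<and> sum f A \<noteq> c}"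
    using fin sub by (intro card_mono) auto
  finally show ?thesis .
qed

text \<open>This is the probability that a random \<open>m\<close>-subset of a \<open>p\<close>-set
  contains one given element and avoids another, with denominators cleared.\<close>

lemma binomial_remove_two:
  assumes "m \<ge> 1" "m \<le> p"
  shows "real p * (real p - 1) * real ((p - 2) choose (m - 1)) =
         real m * (real p - real m) * real (p choose m)"
proof -
  have 1: "m * (p choose m) = p * ((p - 1) choose (m - 1))"
    using assms by (intro times_binomial_minus1_eq) simp
  have 2: "(p - m) * ((p - 1) choose (m - 1)) = (p - 1) * ((p - 2) choose (m - 1))"
    using binomial_absorb_comp[of "p - 1" "m - 1"] assms by (simp add: numeral_2_eq_2)
  have "m * (p - m) * (p choose m) = p * (p - 1) * ((p - 2) choose (m - 1))"
    using 1 2 by (metis mult.assoc mult.commute)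
  then have "real (m * (p - m) * (p choose m)) = real (p * (p - 1) * ((p - 2) choose (m - 1)))"
    by (rule arg_cong)
  then show ?thesis
    using assms by (simp add: of_nat_diff)
qed

text \<open>With q = \<open>card Q\<close>, the sets supplied by
  \<open>card_sum_nonzero_swap\<close> amount to the fraction m (q - m) / (q (q - 1)) of all
  \<open>m\<close>-subsets. The hypothesis on \<open>\<beta>\<close> compares it with this fraction
  without dividing.\<close>

lemma swap_fraction:
  fixes f :: "'i \<Rightarrow> int" and \<beta> :: real
  assumes fin: "finite Q" and ij: "i \<in> Q" "j \<in> Q" and ne: "f i \<noteq> f j"
    and m: "1 \<le> m" "m \<le> card Q"
    and \<beta>: "\<beta> * (real (card Q) * (real (card Q) - 1)) \<le> real m * (real (card Q) - real m)"
  shows "\<beta> * real (card {A. A \<subseteq> Q \<and> card A = m}) \<le>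
         (\<Sum>A | A \<subseteq> Q \<and> card A = m. of_bool (sum f A \<noteq> c))"
proof -
  define p where "p = card Q"
  have "card {i, j} \<le> card Q" using fin ij by (intro card_mono) auto
  moreover have "i \<noteq> j" using ne by auto
  ultimately have p2: "p \<ge> 2" by (simp add: p_def)
  then have pos: "real p * (real p - 1) > 0" by simp
  have "\<beta> * real (p choose m) * (real p * (real p - 1)) \<le>
        real m * (real p - real m) * real (p choose m)"
    using mult_right_mono[OF \<beta>, of "real (p choose m)"] by (simp add: p_def mult_ac)
  also have "\<dots> = real ((p - 2) choose (m - 1)) * (real p * (real p - 1))"
    using binomial_remove_two[of m p] m by (simp add: p_def mult_ac)
  finally have "\<beta> * real (p choose m) \<le> real ((p - 2) choose (m - 1))"
    by (rule mult_right_le_imp_le[OF _ pos])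
  also have "\<dots> \<le> real (card {A. A \<subseteq> Q \<and> card A = m \<and> sum f A \<noteq> c})"
    using card_sum_nonzero_swap[OF fin ij ne m(1)] by (simp add: p_def)
  also have "\<dots> = (\<Sum>A | A \<subseteq> Q \<and> card A = m. of_bool (sum f A \<noteq> c))"
    using fin by (simp add: conj_assoc Int_def flip: of_nat_sum)
  finally show ?thesis using fin by (simp add: n_subsets p_def)
qed

text \<open>Pair each \<open>Z\<close> avoiding \<open>z\<close> with \<open>insert z Z\<close>:
  their sums differ by \<open>f z\<close>, so at least one of them is not \<open>c\<close>.\<close>

lemma toggle_fraction:
  fixes f :: "'i \<Rightarrow> int"
  assumes fin: "finite Q" and z: "z \<in> Q" and ne: "f z \<noteq> 0"
  shows "real (card (Pow Q)) / 2 \<le> (\<Sum>Z\<in>Pow Q. of_bool (sum f Z \<noteq> c))"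
proof -
  define g where "g Z = (if sum f Z \<noteq> c then Z else insert z Z)" for Z
  have inj: "inj_on g (Pow (Q - {z}))"
    by (rule inj_on_inverseI[where g = "\<lambda>A. A - {z}"]) (auto simp: g_def)
  have "g ` Pow (Q - {z}) \<subseteq> {Z \<in> Pow Q. sum f Z \<noteq> c}"
  proof safe
    fix Z assume Z: "Z \<subseteq> Q - {z}"
    then have "finite Z" "z \<notin> Z" using fin by (auto dest: finite_subset)
    then show "c = sum f (g Z) \<Longrightarrow> False"
      using ne by (auto simp: g_def split: if_splits)
    show "x \<in> Q" if "x \<in> g Z" for x
      using that Z z by (auto simp: g_def split: if_splits)
  qed
  then have "card (g ` Pow (Q - {z})) \<le> card {Z \<in> Pow Q. sum f Z \<noteq> c}"
    using fin by (intro card_mono) auto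
  then have "card (Pow (Q - {z})) \<le> card {Z \<in> Pow Q. sum f Z \<noteq> c}"
    by (simp add: card_image[OF inj])
  moreover have "card (Pow Q) = 2 * card (Pow (Q - {z}))"
    using fin by (simp only: card_Pow finite_Diff card.remove[OF fin z] power_Suc)
  moreover have "(\<Sum>Z\<in>Pow Q. of_bool (sum f Z \<noteq> c)) = real (card {Z \<in> Pow Q. sum f Z \<noteq> c})"
    using fin by (simp add: Int_def)
  ultimately show ?thesis by linarith
qed

section \<open>Unsplit families and their sign pattern\<close>

text \<open>\<open>W\<close> stands for the gain vectors of an unsplit set of hypotheses, and
  \<open>i0\<close> for the coordinate in which the two adjacent tests differ. The last assumption
  places the proportion of positive sums outside the interval from \<alpha> to 1 - \<alpha>,
  multiplied through by \<open>card W\<close>.\<close>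

locale unsplit =
  fixes I :: "'i set" and W :: "('i \<Rightarrow> int) set" and i0 :: 'i and \<alpha> :: real
  assumes finI: "finite I" and finW: "finite W" and W_ne: "W \<noteq> {}"
    and W_sub: "W \<subseteq> I \<rightarrow>\<^sub>E {-1, 0, 1}"
    and i0: "i0 \<in> I" and W_i0: "a \<in> W \<Longrightarrow> a i0 = 1"
    and \<alpha>: "0 < \<alpha>" "\<alpha> \<le> 1/16"
    and unsplit: "S \<subseteq> I \<Longrightarrow>
      (\<Sum>a\<in>W. of_bool (sum a S > 0)) < \<alpha> * real (card W) \<or>
      (\<Sum>a\<in>W. of_bool (sum a S \<le> 0)) < \<alpha> * real (card W)"
begin

text \<open>Counting by a real sum of indicators makes union bounds termwise and turns double
  counting into an exchange of sums.\<close>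

definition cnt :: "(('i \<Rightarrow> int) \<Rightarrow> bool) \<Rightarrow> real" where
  "cnt Q = (\<Sum>a\<in>W. of_bool (Q a))"

definition rare :: "(('i \<Rightarrow> int) \<Rightarrow> bool) \<Rightarrow> bool" where
  "rare Q \<longleftrightarrow> cnt Q < \<alpha> * real (card W)"

definition pos :: "'i set" where
  "pos = {j \<in> I. rare (\<lambda>a. a j \<le> 0)}"

definition neg :: "'i set" where
  "neg = {j \<in> I. rare (\<lambda>a. a j \<ge> 0)}"

text \<open>The name anticipates \<open>cnt_ne_mode\<close>: on these leftover coordinates both
  signs turn out to be rare, so almost all gains vanish.\<close>

definition zer :: "'i set" where
  "zer = I - pos - neg"

lemma card_W_pos: "real (card W) > 0"
  using finW W_ne by (simp add: card_gt_0_iff)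

lemma alpha_card: "0 < \<alpha> * real (card W)" "16 * (\<alpha> * real (card W)) \<le> real (card W)"
  using \<alpha> card_W_pos by (auto simp: mult_left_le_one_le)

lemma W_range: "a \<in> W \<Longrightarrow> j \<in> I \<Longrightarrow> a j \<in> {-1, 0, 1}"
  using W_sub by (meson PiE_mem subsetD)

lemma cnt_le_add3:
  assumes "\<And>a. a \<in> W \<Longrightarrow> Q a \<Longrightarrow> R a \<or> S a \<or> T a"
  shows "cnt Q \<le> cnt R + cnt S + cnt T"
  unfolding cnt_def sum.distrib[symmetric] using assms by (intro sum_mono) auto

lemma cnt_False [simp]: "cnt (\<lambda>_. False) = 0"
  by (simp add: cnt_def)

lemma cnt_True [simp]: "cnt (\<lambda>_. True) = real (card W)"
  by (simp add: cnt_def)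

lemma cnt_mono: "(\<And>a. a \<in> W \<Longrightarrow> Q a \<Longrightarrow> R a) \<Longrightarrow> cnt Q \<le> cnt R"
  using cnt_le_add3[of Q R "\<lambda>_. False" "\<lambda>_. False"] by simp

lemma cnt_le_add:
  "(\<And>a. a \<in> W \<Longrightarrow> Q a \<Longrightarrow> R a \<or> S a) \<Longrightarrow> cnt Q \<le> cnt R + cnt S"
  using cnt_le_add3[of Q R S "\<lambda>_. False"] by simp

lemma cnt_le_card: "cnt Q \<le> real (card W)"
  using cnt_mono[of Q "\<lambda>_. True"] by simp

lemma rare_dichotomy: "S \<subseteq> I \<Longrightarrow> rare (\<lambda>a. sum a S > 0) \<or> rare (\<lambda>a. sum a S \<le> 0)"
  using unsplit[of S] by (simp add: rare_def cnt_def)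

lemma i0_pos: "i0 \<in> pos"
proof -
  have "cnt (\<lambda>a. a i0 \<le> 0) \<le> cnt (\<lambda>_. False)"
    by (rule cnt_mono) (simp add: W_i0)
  then show ?thesis
    using i0 alpha_card by (simp add: pos_def rare_def)
qed

lemma pos_neg_zer: "pos \<subseteq> I" "neg \<subseteq> I" "zer \<subseteq> I" "pos \<inter> neg = {}" "pos \<inter> zer = {}"
  "neg \<inter> zer = {}" "pos \<union> neg \<union> zer = I" "finite pos" "finite neg" "finite zer"
proof -
  show "pos \<inter> neg = {}"
  proof safe
    fix j assume "j \<in> pos" "j \<in> neg"
    then have "cnt (\<lambda>a. a j \<le> 0) < \<alpha> * real (card W)" "cnt (\<lambda>a. a j \<ge> 0) < \<alpha> * real (card W)"
      by (auto simp: pos_def neg_def rare_def)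
    moreover have "cnt (\<lambda>_. True) \<le> cnt (\<lambda>a. a j \<le> 0) + cnt (\<lambda>a. a j \<ge> 0)"
      by (rule cnt_le_add) auto
    ultimately show "j \<in> {}"
      using alpha_card by simp
  qed
  show "finite pos" "finite neg" "finite zer"
    using finI by (auto simp: pos_def neg_def zer_def)
qed (auto simp: pos_def neg_def zer_def)

lemma rare_pos_outside: "j \<in> I \<Longrightarrow> j \<notin> pos \<Longrightarrow> rare (\<lambda>a. a j > 0)"
  using rare_dichotomy[of "{j}"] by (auto simp: pos_def)

text \<open>A singleton only separates positive gains from the rest. Adding \<open>i0\<close>, where
  every gain is 1, shifts the threshold: 1 + \<open>a j\<close> is positive iff \<open>a j\<close>
  is nonnegative.\<close>

lemma rare_neg_outside:
  assumes j: "j \<in> I" "j \<notin> neg"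
  shows "rare (\<lambda>a. a j < 0)"
proof (cases "j = i0")
  case True
  have "cnt (\<lambda>a. a j < 0) \<le> cnt (\<lambda>_. False)"
    by (rule cnt_mono) (simp add: True W_i0)
  then show ?thesis using alpha_card by (simp add: rare_def)
next
  case False
  then have sum: "sum a {i0, j} = 1 + a j" if "a \<in> W" for a
    using that by (simp add: W_i0)
  have "cnt (\<lambda>a. a j \<ge> 0) \<le> cnt (\<lambda>a. sum a {i0, j} > 0)"
    by (rule cnt_mono) (simp add: sum)
  moreover have "\<not> cnt (\<lambda>a. a j \<ge> 0) < \<alpha> * real (card W)"
    using j by (simp add: neg_def rare_def)
  ultimately have "rare (\<lambda>a. sum a {i0, j} \<le> 0)"
    using rare_dichotomy[of "{i0, j}"] j i0 by (auto simp: rare_def)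
  moreover have "cnt (\<lambda>a. a j < 0) \<le> cnt (\<lambda>a. sum a {i0, j} \<le> 0)"
    by (rule cnt_mono) (auto simp: sum)
  ultimately show ?thesis by (simp add: rare_def)
qed

text \<open>Restricted to \<open>I\<close> so that it equals a member of \<open>W\<close> as soon as
  both agree on \<open>I\<close>.\<close>

definition mode :: "'i \<Rightarrow> int" where
  "mode = (\<lambda>j\<in>I. if j \<in> pos then 1 else if j \<in> neg then -1 else 0)"

text \<open>The factor 2 comes from \<open>zer\<close>, where a deviation may have either sign; on
  \<open>pos\<close> and \<open>neg\<close> a single rare event covers all deviations.\<close>

lemma cnt_ne_mode:
  assumes "j \<in> I"
  shows "cnt (\<lambda>a. a j \<noteq> mode j) < 2 * (\<alpha> * real (card W))"
proof -
  consider "j \<in> pos" | "j \<in> neg" | "j \<notin> pos" "j \<notin> neg" by blast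
  then show ?thesis
  proof cases
    case 1
    have "cnt (\<lambda>a. a j \<noteq> mode j) \<le> cnt (\<lambda>a. a j \<le> 0)"
      using 1 assms by (intro cnt_mono) (auto simp: mode_def dest: W_range[OF _ assms])
    then show ?thesis using 1 alpha_card by (auto simp: pos_def rare_def)
  next
    case 2
    then have "j \<notin> pos" using pos_neg_zer by auto
    then have "cnt (\<lambda>a. a j \<noteq> mode j) \<le> cnt (\<lambda>a. a j \<ge> 0)"
      using 2 assms by (intro cnt_mono) (auto simp: mode_def dest: W_range[OF _ assms])
    then show ?thesis using 2 alpha_card by (auto simp: neg_def rare_def)
  next
    case 3
    then have "cnt (\<lambda>a. a j \<noteq> mode j) \<le> cnt (\<lambda>a. a j > 0) + cnt (\<lambda>a. a j < 0)"
      using assms by (intro cnt_le_add) (auto simp: mode_def)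
    then show ?thesis
      using rare_pos_outside[of j] rare_neg_outside[of j] 3 assms by (simp add: rare_def)
  qed
qed

section \<open>Sets whose gains almost always cancel\<close>

definition tight :: "'i set \<Rightarrow> bool" where
  "tight S \<longleftrightarrow> rare (\<lambda>a. sum a S > 0) \<and> rare (\<lambda>a. sum a S < 0)"

text \<open>
  Since \<open>6 * \<alpha> < 1\<close>, a crude bound on the deviation of \<open>sum a S\<close> from \<open>0\<close> improves itself to a
  sharp one, so errors do not accumulate along a chain of sets.
\<close>

lemma tight_improve:
  assumes S: "S \<subseteq> I" and j: "j \<in> pos" "j \<notin> S"
    and dev: "cnt (\<lambda>a. sum a S \<noteq> 0) \<le> 4 * (\<alpha> * real (card W))"
  shows "tight S"
proof -
  have jI: "j \<in> I" and aj: "cnt (\<lambda>a. a j \<le> 0) < \<alpha> * real (card W)"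
    using j by (auto simp: pos_def rare_def)
  have ins: "sum a (insert j S) = a j + sum a S" for a :: "'i \<Rightarrow> int"
    using j finite_subset[OF S finI] by simp
  have "cnt (\<lambda>_. True) \<le> cnt (\<lambda>a. sum a S \<noteq> 0) + cnt (\<lambda>a. sum a S \<le> 0)"
    by (rule cnt_le_add) auto
  then have 1: "rare (\<lambda>a. sum a S > 0)"
    using rare_dichotomy[OF S] dev alpha_card by (auto simp: rare_def)
  \<comment> \<open>Apart from a fraction of less than 5 \<alpha>, the sum over \<open>S\<close> is
    0 and \<open>a j\<close> is positive, so a positive sum over \<open>insert j S\<close> is not
    rare. The dichotomy then makes a nonpositive one rare, which covers negative sums over
    \<open>S\<close> because \<open>a j\<close> is at most 1.\<close>
  have "cnt (\<lambda>_. True) \<le>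
      cnt (\<lambda>a. sum a S \<noteq> 0) + cnt (\<lambda>a. a j \<le> 0) + cnt (\<lambda>a. sum a (insert j S) > 0)"
    by (rule cnt_le_add3) (auto simp: ins)
  then have "rare (\<lambda>a. sum a (insert j S) \<le> 0)"
    using rare_dichotomy[of "insert j S"] S jI dev aj alpha_card by (auto simp: rare_def)
  moreover have "cnt (\<lambda>a. sum a S < 0) \<le> cnt (\<lambda>a. sum a (insert j S) \<le> 0)"
    using W_range[OF _ jI] by (intro cnt_mono) (fastforce simp: ins)
  ultimately show ?thesis using 1 by (simp add: tight_def rare_def)
qed

lemma tight_cnt_ne:
  assumes "tight S"
  shows "cnt (\<lambda>a. sum a S \<noteq> 0) \<le> 2 * (\<alpha> * real (card W))"
proof -
  have "cnt (\<lambda>a. sum a S \<noteq> 0) \<le> cnt (\<lambda>a. sum a S > 0) + cnt (\<lambda>a. sum a S < 0)"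
    by (rule cnt_le_add) auto
  then show ?thesis using assms by (simp add: tight_def rare_def)
qed

text \<open>Add one positive and one negative coordinate at a time. Their gains cancel outside two
  rare events, so the deviation grows from 2 \<alpha> to at most 4 \<alpha>, which
  \<open>tight_improve\<close> accepts. Strictness of \<open>A \<subset> pos\<close> leaves the
  spare positive coordinate that \<open>tight_improve\<close> asks for.\<close>

lemma tight_pairs:
  assumes "card A = n" "card B = n" "A \<subset> pos" "B \<subseteq> neg"
  shows "tight (A \<union> B)"
  using assms
proof (induction n arbitrary: A B)
  case 0
  then have "A = {}" "B = {}"
    using pos_neg_zer by (auto dest: finite_subset)
  then show ?case using alpha_card by (simp add: tight_def rare_def)
next
  case (Suc n)
  then obtain j A' k B' where A: "A = insert j A'" "j \<notin> A'" "card A' = n"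
    and B: "B = insert k B'" "k \<notin> B'" "card B' = n"
    by (metis card_Suc_eq)
  have fin: "finite A'" "finite B'"
    using Suc.prems A B pos_neg_zer by (auto dest: finite_subset)
  have tight': "tight (A' \<union> B')"
    using Suc.prems A B by (intro Suc.IH) auto
  from Suc.prems obtain l where l: "l \<in> pos" "l \<notin> A" by auto
  have jk: "j \<in> pos" "k \<in> neg" using Suc.prems A B by auto
  have "j \<notin> B'" "k \<notin> A'" "j \<noteq> k" "l \<notin> B"
    using Suc.prems A B l jk pos_neg_zer by auto
  then have sum: "sum a (A \<union> B) = a j + a k + sum a (A' \<union> B')" for a :: "'i \<Rightarrow> int"
    using A B fin by simp
  have range: "a j \<in> {-1, 0, 1}" "a k \<in> {-1, 0, 1}" if "a \<in> W" for a
    using W_range[OF that] jk pos_neg_zer by auto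
  have "cnt (\<lambda>a. sum a (A \<union> B) \<noteq> 0) \<le>
      cnt (\<lambda>a. sum a (A' \<union> B') \<noteq> 0) + cnt (\<lambda>a. a j \<le> 0) + cnt (\<lambda>a. a k \<ge> 0)"
    by (rule cnt_le_add3) (use range in \<open>fastforce simp: sum\<close>)
  also have "\<dots> \<le> 4 * (\<alpha> * real (card W))"
    using tight_cnt_ne[OF tight'] jk by (simp add: pos_def neg_def rare_def)
  finally show ?case
    using l \<open>l \<notin> B\<close> Suc.prems pos_neg_zer by (intro tight_improve[of _ l]) auto
qed

text \<open>Each coordinate of \<open>zer\<close> again costs at most 2 \<alpha> by
  \<open>cnt_ne_mode\<close>, and \<open>tight_improve\<close> restores the sharp bound before the
  next one is added.\<close>

lemma tight_balanced:
  assumes AB: "card A = card B" "A \<subset> pos" "B \<subseteq> neg" and Z: "Z \<subseteq> zer"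
  shows "tight (A \<union> B \<union> Z)"
proof -
  have "finite Z" using Z pos_neg_zer by (auto dest: finite_subset)
  moreover obtain l where l: "l \<in> pos" "l \<notin> A" using AB by auto
  have l': "l \<notin> B" "l \<notin> zer" using l AB pos_neg_zer by auto
  have finAB: "finite A" "finite B"
    using AB pos_neg_zer by (auto dest: finite_subset)
  ultimately show ?thesis using Z
  proof (induction Z rule: finite_induct)
    case empty
    then show ?case using tight_pairs AB by simp
  next
    case (insert z Z)
    then have z: "z \<in> I" "z \<notin> A" "z \<notin> B" "mode z = 0"
      using AB pos_neg_zer by (auto simp: mode_def)
    have sum: "sum a (A \<union> B \<union> insert z Z) = a z + sum a (A \<union> B \<union> Z)" for a :: "'i \<Rightarrow> int"
      using insert z finAB by simp
    have "cnt (\<lambda>a. sum a (A \<union> B \<union> insert z Z) \<noteq> 0) \<le>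
        cnt (\<lambda>a. sum a (A \<union> B \<union> Z) \<noteq> 0) + cnt (\<lambda>a. a z \<noteq> mode z)"
      unfolding sum z(4) by (rule cnt_le_add) auto
    also have "\<dots> \<le> 4 * (\<alpha> * real (card W))"
      using tight_cnt_ne[of "A \<union> B \<union> Z"] insert cnt_ne_mode[of z] z by simp
    finally show ?case
      using l l' insert AB pos_neg_zer by (intro tight_improve[of _ l]) auto
  qed
qed

section \<open>Averaging the balance hypotheses\<close>

lemma sum_card_eq_sum_cnt: "(\<Sum>a\<in>W. real (card {j \<in> I. Q (a j)})) = (\<Sum>j\<in>I. cnt (\<lambda>a. Q (a j)))"
proof -
  have "(\<Sum>a\<in>W. real (card {j \<in> I. Q (a j)})) = (\<Sum>a\<in>W. \<Sum>j\<in>I. of_bool (Q (a j)))"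
    using finI by (simp add: Int_def)
  also have "\<dots> = (\<Sum>j\<in>I. cnt (\<lambda>a. Q (a j)))"
    unfolding cnt_def by (rule sum.swap)
  finally show ?thesis .
qed

text \<open>Coordinates in \<open>L\<close> satisfy \<open>Q\<close> almost always, the others in
  \<open>K\<close> almost never. Both bounds share one main term, so that 1 - \<alpha> cancels later
  and only an error of \<alpha> \<open>card I\<close> per vector remains.\<close>

lemma sum_cnt_bounds:
  assumes K: "K \<subseteq> I" and L: "L \<subseteq> K"
    and big: "\<And>j. j \<in> L \<Longrightarrow> rare (\<lambda>a. \<not> Q (a j))"
    and small: "\<And>j. j \<in> K - L \<Longrightarrow> rare (\<lambda>a. Q (a j))"
  shows "(1 - \<alpha>) * real (card L) * real (card W) \<le> (\<Sum>j\<in>K. cnt (\<lambda>a. Q (a j)))"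
    and "(\<Sum>j\<in>K. cnt (\<lambda>a. Q (a j))) \<le>
      (1 - \<alpha>) * real (card L) * real (card W) + \<alpha> * real (card I) * real (card W)"
proof -
  have fin: "finite K" "finite L"
    using K L finI by (auto dest: finite_subset)
  have split: "(\<Sum>j\<in>K. cnt (\<lambda>a. Q (a j))) =
      (\<Sum>j\<in>L. cnt (\<lambda>a. Q (a j))) + (\<Sum>j\<in>K-L. cnt (\<lambda>a. Q (a j)))"
    using fin L by (subst sum.subset_diff[of L]) auto
  have nonneg: "0 \<le> (\<Sum>j\<in>K-L. cnt (\<lambda>a. Q (a j)))"
    by (intro sum_nonneg) (auto simp: cnt_def sum_nonneg)
  have "real (card L) * ((1 - \<alpha>) * real (card W)) \<le> (\<Sum>j\<in>L. cnt (\<lambda>a. Q (a j)))"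
  proof (rule sum_bounded_below)
    fix j assume "j \<in> L"
    moreover have "cnt (\<lambda>_. True) \<le> cnt (\<lambda>a. Q (a j)) + cnt (\<lambda>a. \<not> Q (a j))"
      by (rule cnt_le_add) auto
    ultimately show "(1 - \<alpha>) * real (card W) \<le> cnt (\<lambda>a. Q (a j))"
      using big[of j] by (simp add: rare_def algebra_simps)
  qed
  then show "(1 - \<alpha>) * real (card L) * real (card W) \<le> (\<Sum>j\<in>K. cnt (\<lambda>a. Q (a j)))"
    using split nonneg by (simp add: mult_ac)
  have "(\<Sum>j\<in>L. cnt (\<lambda>a. Q (a j))) \<le> real (card L) * real (card W)"
    by (rule sum_bounded_above) (rule cnt_le_card)
  moreover have "(\<Sum>j\<in>K-L. cnt (\<lambda>a. Q (a j))) \<le> real (card (K - L)) * (\<alpha> * real (card W))"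
    using small by (intro sum_bounded_above) (auto simp: rare_def less_imp_le)
  moreover have "real (card (K - L)) * (\<alpha> * real (card W)) \<le>
      (real (card I) - real (card L)) * (\<alpha> * real (card W))"
  proof (rule mult_right_mono)
    have "card (K - L) = card K - card L" using fin L by (simp add: card_Diff_subset)
    then show "real (card (K - L)) \<le> real (card I) - real (card L)"
      using card_mono[OF finI K] card_mono[OF fin(1) L] by linarith
  qed (use alpha_card in simp)
  ultimately show "(\<Sum>j\<in>K. cnt (\<lambda>a. Q (a j))) \<le>
      (1 - \<alpha>) * real (card L) * real (card W) + \<alpha> * real (card I) * real (card W)"
    using split by (simp add: algebra_simps)
qed

text \<open>Sum the hypotheses over \<open>W\<close> and replace the counts by
  \<open>card pos\<close> and \<open>card neg\<close>. The margin \<open>card I\<close> / 8 pays for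
  the error, and the common factor (1 - \<alpha>) N is cancelled.\<close>

lemma card_pos_neg_bounds:
  assumes r: "r > 0" "8 * r * \<alpha> \<le> 1"
    and bal: "\<And>a. a \<in> W \<Longrightarrow> real (card {j \<in> I. a j > 0}) \<le>
        r * real (card {j \<in> I. a j < 0}) - real (card I) / 8"
      "\<And>a. a \<in> W \<Longrightarrow> real (card {j \<in> I. a j < 0}) \<le>
        r * (real (card {j \<in> I. a j > 0}) - 1) - real (card I) / 8"
  shows "real (card pos) \<le> r * real (card neg)"
    and "real (card neg) \<le> r * (real (card pos) - 1)"
proof -
  define N where "N = real (card W)"
  define d where "d = real (card I)"
  define P where "P = (\<Sum>j\<in>I. cnt (\<lambda>a. a j > 0))"
  define M where "M = (\<Sum>j\<in>I. cnt (\<lambda>a. a j < 0))"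
  have N: "N > 0" using card_W_pos by (simp add: N_def)
  have "\<alpha> < 1" using \<alpha> by simp
  then have pos': "(1 - \<alpha>) * N > 0" using N by simp
  \<comment> \<open>This is where the margin d/8 in the hypotheses meets the bound 8 r in the split
    constant.\<close>
  have slack: "r * (\<alpha> * d * N) \<le> d * N / 8"
    using mult_right_mono[OF r(2), of "d * N"] N by (simp add: d_def mult_ac)
  have P_lower: "(1 - \<alpha>) * real (card pos) * N \<le> P"
    unfolding P_def N_def
    by (rule sum_cnt_bounds(1)) (use rare_pos_outside in \<open>auto simp: pos_def not_less\<close>)
  have M_bounds: "(1 - \<alpha>) * real (card neg) * N \<le> M"
      "M \<le> (1 - \<alpha>) * real (card neg) * N + \<alpha> * d * N"
    unfolding M_def N_def d_def
    by (rule sum_cnt_bounds; use rare_neg_outside in \<open>auto simp: neg_def not_less\<close>)+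
  \<comment> \<open>Coordinate \<open>i0\<close> contributes exactly \<open>N\<close>, which matches
    the - 1 in the second hypothesis; the estimate is applied to the other coordinates.\<close>
  have "cnt (\<lambda>a. a i0 > 0) = cnt (\<lambda>_. True)"
    unfolding cnt_def by (intro sum.cong) (auto simp: W_i0)
  then have P_split: "P = N + (\<Sum>j\<in>I - {i0}. cnt (\<lambda>a. a j > 0))"
    unfolding P_def N_def using finI i0 by (simp add: sum.remove)
  have P_rest: "(\<Sum>j\<in>I - {i0}. cnt (\<lambda>a. a j > 0)) \<le>
      (1 - \<alpha>) * real (card (pos - {i0})) * N + \<alpha> * d * N"
    unfolding N_def d_def
    by (rule sum_cnt_bounds; use rare_pos_outside in \<open>auto simp: pos_def not_less\<close>)
  have card_pos: "real (card (pos - {i0})) = real (card pos) - 1"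
    by (simp only: card.remove[OF pos_neg_zer(8) i0_pos] of_nat_Suc)
  have P_upper: "P - N \<le> (1 - \<alpha>) * (real (card pos) - 1) * N + \<alpha> * d * N"
    using P_rest unfolding P_split card_pos by linarith
  have "P \<le> (\<Sum>a\<in>W. r * real (card {j \<in> I. a j < 0}) - d / 8)"
    unfolding P_def sum_card_eq_sum_cnt[of "\<lambda>x. x > 0", symmetric]
    using bal(1) by (intro sum_mono) (simp add: d_def)
  also have "\<dots> = r * M - d * N / 8"
    unfolding M_def sum_card_eq_sum_cnt[of "\<lambda>x. x < 0", symmetric]
    by (simp add: sum_subtractf sum_distrib_left N_def)
  finally have "P \<le> r * M - d * N / 8" .
  moreover have "r * M \<le> r * ((1 - \<alpha>) * real (card neg) * N + \<alpha> * d * N)"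
    using M_bounds(2) r by (intro mult_left_mono) auto
  ultimately have "(1 - \<alpha>) * real (card pos) * N \<le> r * ((1 - \<alpha>) * real (card neg) * N)"
    using P_lower slack by (simp add: distrib_left)
  then have "real (card pos) * ((1 - \<alpha>) * N) \<le> r * real (card neg) * ((1 - \<alpha>) * N)"
    by (simp add: mult_ac)
  then show "real (card pos) \<le> r * real (card neg)"
    by (rule mult_right_le_imp_le[OF _ pos'])
  have "M \<le> (\<Sum>a\<in>W. r * (real (card {j \<in> I. a j > 0}) - 1) - d / 8)"
    unfolding M_def sum_card_eq_sum_cnt[of "\<lambda>x. x < 0", symmetric]
    using bal(2) by (intro sum_mono) (simp add: d_def)
  also have "\<dots> = r * (P - N) - d * N / 8"
    unfolding P_def sum_card_eq_sum_cnt[of "\<lambda>x. x > 0", symmetric]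
    by (simp add: sum_subtractf N_def flip: sum_distrib_left)
  finally have "M \<le> r * (P - N) - d * N / 8" .
  moreover have "r * (P - N) \<le> r * ((1 - \<alpha>) * (real (card pos) - 1) * N + \<alpha> * d * N)"
    using P_upper r by (intro mult_left_mono) auto
  ultimately have "(1 - \<alpha>) * real (card neg) * N \<le>
      r * ((1 - \<alpha>) * (real (card pos) - 1) * N)"
    using M_bounds(1) slack unfolding distrib_left by linarith
  then have "real (card neg) * ((1 - \<alpha>) * N) \<le> r * (real (card pos) - 1) * ((1 - \<alpha>) * N)"
    by (simp add: mult_ac)
  then show "real (card neg) \<le> r * (real (card pos) - 1)"
    by (rule mult_right_le_imp_le[OF _ pos'])
qed

end

section \<open>Choosing the size of the random sets\<close>

text \<open>m (q - m) is concave in m, and between 4 \<alpha> q and q/2 it is smallest at the left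
  end. The value there is 4 \<alpha> (1 - 4 \<alpha>) q^2, and 4 (1 - 4 \<alpha>) is at least
  3.\<close>

lemma concave_fraction:
  fixes m q \<alpha> :: real
  assumes "0 < \<alpha>" "\<alpha> \<le> 1/16" "0 \<le> q" "4 * \<alpha> * q \<le> m" "2 * m \<le> q"
  shows "3 * \<alpha> * (q * (q - 1)) \<le> m * (q - m)"
proof -
  have "0 \<le> (m - 4 * \<alpha> * q) * (q - m - 4 * \<alpha> * q)"
    using assms by (intro mult_nonneg_nonneg) auto
  then have 1: "4 * \<alpha> * (1 - 4 * \<alpha>) * (q * q) \<le> m * (q - m)"
    by (simp add: algebra_simps)
  have "\<alpha> * 3 \<le> \<alpha> * (4 * (1 - 4 * \<alpha>))"
    using assms by (intro mult_left_mono) auto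
  then have "3 * \<alpha> * (q * q) \<le> 4 * \<alpha> * (1 - 4 * \<alpha>) * (q * q)"
    by (intro mult_right_mono) (auto simp: mult_ac)
  moreover have "3 * \<alpha> * (q * (q - 1)) \<le> 3 * \<alpha> * (q * q)"
    using assms by (intro mult_left_mono) auto
  ultimately show ?thesis using 1 by linarith
qed

text \<open>Since 4 m (q - m) = q^2 - (2 m - q)^2, rounding q/2 by at most 1/2 loses at most
  1.\<close>

lemma half_fraction:
  fixes m q \<alpha> :: real
  assumes "0 < \<alpha>" "\<alpha> \<le> 1/16" "1 \<le> q" "q - 1 \<le> 2 * m" "2 * m \<le> q + 1"
  shows "3 * \<alpha> * (q * (q - 1)) \<le> m * (q - m)"
proof -
  have "0 \<le> (2 * m - (q - 1)) * ((q + 1) - 2 * m)"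
    using assms by (intro mult_nonneg_nonneg) auto
  then have "q * q - 1 \<le> 4 * (m * (q - m))"
    by (simp add: algebra_simps)
  moreover have "q * (q - 1) \<le> q * q - 1"
    using assms by (simp add: algebra_simps)
  moreover have "3 * \<alpha> * (q * (q - 1)) \<le> 1/4 * (q * (q - 1))"
    using assms by (intro mult_right_mono) auto
  ultimately show ?thesis by linarith
qed

text \<open>Half of the smaller of \<open>p - 1\<close> and \<open>n\<close>, rounded up, works.
  \<open>half_fraction\<close> handles the smaller class; for the larger one, the ratio bound gives
  4 \<alpha> q \<le> m, as \<open>concave_fraction\<close> requires. Using \<open>p - 1\<close>
  ensures \<open>m < p\<close>.\<close>

lemma exists_balanced_size:
  fixes p n :: nat and r \<alpha> :: real
  assumes \<alpha>: "0 < \<alpha>" "\<alpha> \<le> 1/16" and r: "r > 0" "8 * r * \<alpha> \<le> 1"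
    and p: "p \<ge> 1" "real p \<le> r * real n" and n: "real n \<le> r * (real p - 1)"
  obtains m where "1 \<le> m" "m < p" "m \<le> n"
    "3 * \<alpha> * (real p * (real p - 1)) \<le> real m * (real p - real m)"
    "3 * \<alpha> * (real n * (real n - 1)) \<le> real m * (real n - real m)"
proof -
  have n1: "n \<ge> 1" using p by (cases n) auto
  then have p2: "p \<ge> 2" using p n r by (cases "p = 1") auto
  define m where "m = (min (p - 1) n + 1) div 2"
  have step: "4 * \<alpha> * x \<le> y / 2" if "x \<le> r * y" "0 \<le> y" for x y
  proof -
    have "4 * \<alpha> * x \<le> 4 * \<alpha> * (r * y)" using that \<alpha> by (intro mult_left_mono) auto
    also have "\<dots> = (8 * r * \<alpha>) * y / 2" by simp
    also have "\<dots> \<le> 1 * y / 2"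
      using that r by (intro divide_right_mono mult_right_mono) auto
    finally show ?thesis by simp
  qed
  show thesis
  proof
    show "1 \<le> m" "m < p" "m \<le> n" using n1 p2 by (auto simp: m_def)
    show "3 * \<alpha> * (real p * (real p - 1)) \<le> real m * (real p - real m)"
    proof (cases "p - 1 \<le> n")
      case True
      then have "p - 1 \<le> 2 * m" "2 * m \<le> p + 1" by (auto simp: m_def)
      then show ?thesis using \<alpha> p2 by (intro half_fraction) auto
    next
      case False
      then have "n \<le> 2 * m" "2 * m \<le> p" by (auto simp: m_def)
      then show ?thesis using \<alpha> step[OF p(2)] by (intro concave_fraction) auto
    qed
    show "3 * \<alpha> * (real n * (real n - 1)) \<le> real m * (real n - real m)"
    proof (cases "n \<le> p - 1")
      case True
      then have "n - 1 \<le> 2 * m" "2 * m \<le> n + 1" by (auto simp: m_def)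
      then show ?thesis using \<alpha> n1 by (intro half_fraction) auto
    next
      case False
      then have "p - 1 \<le> 2 * m" "2 * m \<le> n" by (auto simp: m_def)
      then show ?thesis using \<alpha> step[OF n] p2 by (intro concave_fraction) auto
    qed
  qed
qed

section \<open>Double counting over random balanced sets\<close>

context unsplit
begin

text \<open>In each case only one of \<open>A\<close>, \<open>B\<close>, \<open>Z\<close> is varied
  while the other two are fixed: \<open>Z\<close> by toggling, \<open>A\<close> or \<open>B\<close>
  by swapping. In the remaining case the sum is never 0.\<close>

lemma deviation_fraction:
  fixes m :: nat
  defines "\<A> \<equiv> {A. A \<subseteq> pos \<and> card A = m}" and "\<B> \<equiv> {B. B \<subseteq> neg \<and> card B = m}"
  assumes m: "1 \<le> m" "m < card pos" "m \<le> card neg"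
    and mp: "3 * \<alpha> * (real (card pos) * (real (card pos) - 1)) \<le> real m * (real (card pos) - real m)"
    and mn: "3 * \<alpha> * (real (card neg) * (real (card neg) - 1)) \<le> real m * (real (card neg) - real m)"
    and a: "a \<in> W" "a \<noteq> mode"
  shows "3 * \<alpha> * (real (card \<A>) * real (card \<B>) * real (card (Pow zer))) \<le>
    (\<Sum>A\<in>\<A>. \<Sum>B\<in>\<B>. \<Sum>Z\<in>Pow zer. of_bool (sum a (A \<union> B \<union> Z) \<noteq> 0))"
proof -
  note fin = pos_neg_zer(8-10)
  let ?R = "\<Sum>A\<in>\<A>. \<Sum>B\<in>\<B>. \<Sum>Z\<in>Pow zer. of_bool (sum a A + sum a B + sum a Z \<noteq> 0) :: real"
  have "sum a (A \<union> B \<union> Z) = sum a A + sum a B + sum a Z"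
    if "A \<in> \<A>" "B \<in> \<B>" "Z \<in> Pow zer" for A B Z
  proof -
    have "A \<inter> B = {}" "(A \<union> B) \<inter> Z = {}" "finite A" "finite B" "finite Z"
      using that pos_neg_zer by (auto simp: \<A>_def \<B>_def dest: finite_subset)
    then show ?thesis by (simp add: sum.union_disjoint)
  qed
  then have R: "(\<Sum>A\<in>\<A>. \<Sum>B\<in>\<B>. \<Sum>Z\<in>Pow zer. of_bool (sum a (A \<union> B \<union> Z) \<noteq> 0)) = ?R"
    by (intro sum.cong refl) simp
  have "mode \<in> extensional I" "a \<in> extensional I"
    using W_sub a(1) by (auto simp: mode_def PiE_def)
  then obtain j where j: "j \<in> I" "a j \<noteq> mode j"
    using a(2) extensionalityI[of a I mode] by blast
  have range: "a k \<in> {-1, 0, 1}" if "k \<in> I" for k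
    using W_range[OF a(1) that] .
  \<comment> \<open>In \<open>pos\<close> the reference value is 1 because \<open>a i0 = 1\<close>.
    If \<open>a\<close> vanishes on \<open>zer\<close>, is 1 on \<open>pos\<close> and constant on
    \<open>neg\<close>, then that constant is not -1 as \<open>a\<close> differs from
    \<open>mode\<close>; this is the case \<open>flat\<close>.\<close>
  consider (zer) k where "k \<in> zer" "a k \<noteq> 0"
    | (pos) k where "k \<in> pos" "a k \<noteq> 1"
    | (neg) k l where "k \<in> neg" "l \<in> neg" "a k \<noteq> a l"
    | (flat) "\<forall>k\<in>zer. a k = 0" "\<forall>k\<in>pos. a k = 1" "\<forall>k\<in>neg. a k \<ge> 0"
  proof (cases "(\<forall>k\<in>zer. a k = 0) \<and> (\<forall>k\<in>pos. a k = 1) \<and> (\<forall>k\<in>neg. \<forall>l\<in>neg. a k = a l)")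
    case True
    then have zp: "\<forall>k\<in>zer. a k = 0" "\<forall>k\<in>pos. a k = 1" by blast+
    then have aj: "j \<in> neg" "a j \<noteq> -1"
      using j by (auto simp: mode_def zer_def split: if_splits)
    have "a k \<ge> 0" if "k \<in> neg" for k
    proof -
      have "a k = a j" using True that aj(1) by blast
      then show ?thesis using range[OF j(1)] aj(2) by auto
    qed
    then show thesis using zp flat by blast
  qed (use zer pos neg in blast)
  then have "3 * \<alpha> * (real (card \<A>) * real (card \<B>) * real (card (Pow zer))) \<le> ?R"
  proof cases
    case zer
    have eq: "(b + c + s \<noteq> 0) = (s \<noteq> - b - c)" for s b c :: int by auto
    have "3 * \<alpha> * real (card (Pow zer)) \<le> (\<Sum>Z\<in>Pow zer. of_bool (b + c + sum a Z \<noteq> 0))" for b c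
    proof -
      have "3 * \<alpha> * real (card (Pow zer)) \<le> 1/2 * real (card (Pow zer))"
        using \<alpha> by (intro mult_right_mono) auto
      also have "\<dots> \<le> (\<Sum>Z\<in>Pow zer. of_bool (sum a Z \<noteq> - b - c))"
        using toggle_fraction[where f = a, OF fin(3) zer, of "- b - c"] by linarith
      finally show ?thesis by (simp only: eq)
    qed
    then have "(\<Sum>A\<in>\<A>. \<Sum>B\<in>\<B>. 3 * \<alpha> * real (card (Pow zer))) \<le> ?R"
      by (intro sum_mono)
    then show ?thesis by (simp add: mult_ac)
  next
    case pos
    have eq: "(s + b + c \<noteq> 0) = (s \<noteq> - b - c)" for s b c :: int by auto
    have "3 * \<alpha> * real (card \<A>) \<le> (\<Sum>A\<in>\<A>. of_bool (sum a A + b + c \<noteq> 0))" for b c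
      unfolding \<A>_def eq using pos i0_pos W_i0[OF a(1)] m mp
      by (intro swap_fraction[OF fin(1), of i0 k]) auto
    then have "(\<Sum>B\<in>\<B>. \<Sum>Z\<in>Pow zer. 3 * \<alpha> * real (card \<A>)) \<le>
      (\<Sum>B\<in>\<B>. \<Sum>Z\<in>Pow zer. \<Sum>A\<in>\<A>. of_bool (sum a A + sum a B + sum a Z \<noteq> 0))"
      by (intro sum_mono)
    also have "\<dots> = ?R"
      by (subst sum.swap[of _ _ \<A>]) (intro sum.cong refl sum.swap)
    finally show ?thesis by (simp add: mult_ac)
  next
    case neg
    have eq: "(b + s + c \<noteq> 0) = (s \<noteq> - b - c)" for s b c :: int by auto
    have "3 * \<alpha> * real (card \<B>) \<le> (\<Sum>B\<in>\<B>. of_bool (b + sum a B + c \<noteq> 0))" for b c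
      unfolding \<B>_def eq using neg m mn by (intro swap_fraction[OF fin(2), of k l]) auto
    then have "(\<Sum>A\<in>\<A>. \<Sum>Z\<in>Pow zer. 3 * \<alpha> * real (card \<B>)) \<le>
      (\<Sum>A\<in>\<A>. \<Sum>Z\<in>Pow zer. \<Sum>B\<in>\<B>. of_bool (sum a A + sum a B + sum a Z \<noteq> 0))"
      by (intro sum_mono)
    also have "\<dots> = ?R"
      by (intro sum.cong refl sum.swap)
    finally show ?thesis by (simp add: mult_ac)
  next
    case flat
    \<comment> \<open>The positive part contributes exactly \<open>m \<ge> 1\<close>, and nothing on
      \<open>neg\<close> or \<open>zer\<close> can offset it.\<close>
    have "sum a A + sum a B + sum a Z \<noteq> 0"
      if "A \<in> \<A>" "B \<in> \<B>" "Z \<in> Pow zer" for A B Z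
    proof -
      have "sum a A = (\<Sum>k\<in>A. 1)" "sum a Z = (\<Sum>k\<in>Z. 0)"
        by (rule sum.cong; use that flat in \<open>auto simp: \<A>_def\<close>)+
      moreover have "sum a B \<ge> 0"
        using that flat by (auto simp: \<B>_def intro!: sum_nonneg)
      ultimately show ?thesis using that m by (simp add: \<A>_def)
    qed
    then have "?R = (\<Sum>A\<in>\<A>. \<Sum>B\<in>\<B>. \<Sum>Z\<in>Pow zer. 1)"
      by (intro sum.cong refl) simp
    then have "?R = 1 * (real (card \<A>) * real (card \<B>) * real (card (Pow zer)))"
      by simp
    moreover have "3 * \<alpha> * (real (card \<A>) * real (card \<B>) * real (card (Pow zer))) \<le>
        1 * (real (card \<A>) * real (card \<B>) * real (card (Pow zer)))"
      using \<alpha> by (intro mult_right_mono) auto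
    ultimately show ?thesis by linarith
  qed
  then show ?thesis using R by simp
qed

text \<open>Count pairs of a vector and a balanced set with nonzero sum. Tightness allows at most a
  fraction 2 \<alpha> for each set, while each vector other than \<open>mode\<close> needs 3
  \<alpha>; hence 3 (|W| - 1) \<le> 2 |W|.\<close>

lemma card_W_eq_1:
  assumes r: "r > 0" "8 * r * \<alpha> \<le> 1"
    and bal: "\<And>a. a \<in> W \<Longrightarrow> real (card {j \<in> I. a j > 0}) \<le>
        r * real (card {j \<in> I. a j < 0}) - real (card I) / 8"
      "\<And>a. a \<in> W \<Longrightarrow> real (card {j \<in> I. a j < 0}) \<le>
        r * (real (card {j \<in> I. a j > 0}) - 1) - real (card I) / 8"
  shows "card W = 1"
proof -
  note fin = pos_neg_zer(8-10)
  have "card pos \<ge> 1" using i0_pos fin by (auto simp: Suc_le_eq card_gt_0_iff)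
  with card_pos_neg_bounds[OF r bal] obtain m where m: "1 \<le> m" "m < card pos" "m \<le> card neg"
    "3 * \<alpha> * (real (card pos) * (real (card pos) - 1)) \<le> real m * (real (card pos) - real m)"
    "3 * \<alpha> * (real (card neg) * (real (card neg) - 1)) \<le> real m * (real (card neg) - real m)"
    using exists_balanced_size[OF \<alpha> r] by metis
  define \<A> where "\<A> = {A. A \<subseteq> pos \<and> card A = m}"
  define \<B> where "\<B> = {B. B \<subseteq> neg \<and> card B = m}"
  define F where "F = real (card \<A>) * real (card \<B>) * real (card (Pow zer))"
  define D where "D a = (\<Sum>A\<in>\<A>. \<Sum>B\<in>\<B>. \<Sum>Z\<in>Pow zer. of_bool (sum a (A \<union> B \<union> Z) \<noteq> 0) :: real)"
    for a :: "'i \<Rightarrow> int"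
  have F: "F > 0"
    using m fin by (auto simp: F_def \<A>_def \<B>_def n_subsets card_Pow intro!: mult_pos_pos)
  have "(\<Sum>a\<in>W. D a) = (\<Sum>A\<in>\<A>. \<Sum>B\<in>\<B>. \<Sum>Z\<in>Pow zer. cnt (\<lambda>a. sum a (A \<union> B \<union> Z) \<noteq> 0))"
    unfolding D_def cnt_def by (simp only: sum.swap[of _ _ W])
  also have "\<dots> \<le> (\<Sum>A\<in>\<A>. \<Sum>B\<in>\<B>. \<Sum>Z\<in>Pow zer. 2 * (\<alpha> * real (card W)))"
    by (intro sum_mono tight_cnt_ne tight_balanced) (use m in \<open>auto simp: \<A>_def \<B>_def\<close>)
  finally have upper: "(\<Sum>a\<in>W. D a) \<le> 2 * real (card W) * (\<alpha> * F)"
    by (simp add: F_def mult_ac)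
  have "real (card (W - {mode})) * (3 * \<alpha> * F) \<le> (\<Sum>a\<in>W - {mode}. D a)"
  proof (rule sum_bounded_below)
    show "3 * \<alpha> * F \<le> D a" if "a \<in> W - {mode}" for a
      using deviation_fraction[OF m, of a] that by (simp add: F_def D_def \<A>_def \<B>_def)
  qed
  also have "\<dots> \<le> (\<Sum>a\<in>W. D a)"
    using finW by (intro sum_mono2) (auto simp: D_def intro!: sum_nonneg)
  also note upper
  finally have "3 * real (card (W - {mode})) * (\<alpha> * F) \<le> 2 * real (card W) * (\<alpha> * F)"
    by (simp add: mult_ac)
  then have "3 * real (card (W - {mode})) \<le> 2 * real (card W)"
    using F \<alpha> by (auto dest: mult_right_le_imp_le)
  moreover have "card W \<le> card (W - {mode}) + 1"
    using finW by (cases "mode \<in> W") (auto simp: card_Diff_singleton)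
  ultimately have small: "card W \<le> 3" by linarith
  have "a = mode" if a: "a \<in> W" for a
  proof (rule extensionalityI[of _ I])
    show "a \<in> extensional I" "mode \<in> extensional I"
      using W_sub a by (auto simp: mode_def PiE_def)
    fix j assume j: "j \<in> I"
    show "a j = mode j"
    proof (rule ccontr)
      assume "a j \<noteq> mode j"
      \<comment> \<open>With at most 3 vectors, fewer than 2 \<alpha> |W| \<le> 6/16 of them
        disagree with \<open>mode\<close> at \<open>j\<close>, so none does.\<close>
      then have "1 \<le> cnt (\<lambda>a. a j \<noteq> mode j)"
        using a finW member_le_sum[of a W "\<lambda>a. of_bool (a j \<noteq> mode j) :: real"]
        by (simp add: cnt_def)
      also have "\<dots> < 2 * (\<alpha> * real (card W))" using cnt_ne_mode[OF j] .
      also have "\<dots> \<le> 2 * (1/16 * 3)"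
        using \<alpha> small by (intro mult_left_mono mult_mono) auto
      finally show False by simp
    qed
  qed
  then have "W = {mode}" using W_ne by auto
  then show ?thesis by (metis One_nat_def card_1_singleton_iff)
qed

end

section \<open>Existence of a splitting set\<close>

lemma exists_balanced_split:
  fixes I :: "'i set" and W :: "('i \<Rightarrow> int) set" and i :: 'i and \<alpha> r :: real
  assumes "finite I" "W \<subseteq> I \<rightarrow>\<^sub>E {-1, 0, 1}" "card W \<ge> 2" "i \<in> I" "\<And>a. a \<in> W \<Longrightarrow> a i = 1"
    and "0 < \<alpha>" "\<alpha> \<le> 1/16" "r > 0" "8 * r * \<alpha> \<le> 1"
    and "\<And>a. a \<in> W \<Longrightarrow> real (card {j \<in> I. a j > 0}) \<le>
        r * real (card {j \<in> I. a j < 0}) - real (card I) / 8"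
      "\<And>a. a \<in> W \<Longrightarrow> real (card {j \<in> I. a j < 0}) \<le>
        r * (real (card {j \<in> I. a j > 0}) - 1) - real (card I) / 8"
  obtains S where "S \<subseteq> I"
    "(\<Sum>a\<in>W. of_bool (sum a S > 0)) / real (card W) \<in> {\<alpha>..1 - \<alpha>}"
proof (rule ccontr)
  note found = that
  assume "\<not> thesis"
  then have no: "(\<Sum>a\<in>W. of_bool (sum a S > 0)) / real (card W) \<notin> {\<alpha>..1 - \<alpha>}" if "S \<subseteq> I" for S
    using found that by blast
  have W: "finite W" "W \<noteq> {}" using assms(3) by (auto intro: card_ge_0_finite)
  then have N: "real (card W) > 0" by (simp add: card_gt_0_iff)
  have "(\<Sum>a\<in>W. of_bool (sum a S > 0)) < \<alpha> * real (card W) \<or>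
      (\<Sum>a\<in>W. of_bool (sum a S \<le> 0)) < \<alpha> * real (card W)" if S: "S \<subseteq> I" for S
  proof -
    have "(\<Sum>a\<in>W. of_bool (sum a S > 0)) + (\<Sum>a\<in>W. of_bool (sum a S \<le> 0)) = (\<Sum>a\<in>W. 1::real)"
      unfolding sum.distrib[symmetric] by (intro sum.cong) auto
    then have "(\<Sum>a\<in>W. of_bool (sum a S > 0)) + (\<Sum>a\<in>W. of_bool (sum a S \<le> 0)) = real (card W)"
      by simp
    moreover have "(\<Sum>a\<in>W. of_bool (sum a S > 0)) / real (card W) < \<alpha> \<or>
        1 - \<alpha> < (\<Sum>a\<in>W. of_bool (sum a S > 0)) / real (card W)"
      using no[OF S] by (auto simp del: sum_of_bool_eq)
    then have "(\<Sum>a\<in>W. of_bool (sum a S > 0)) < \<alpha> * real (card W) \<or>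
        (1 - \<alpha>) * real (card W) < (\<Sum>a\<in>W. of_bool (sum a S > 0))"
      by (simp only: pos_divide_less_eq[OF N] pos_less_divide_eq[OF N])
    ultimately show ?thesis by (auto simp del: sum_of_bool_eq simp: left_diff_distrib)
  qed
  then interpret unsplit I W i \<alpha>
    using assms W by unfold_locales auto
  show False
    using card_W_eq_1[of r] assms by auto
qed

section \<open>Flipping coordinates of a test\<close>

lemma linear_classifier_at:
  "x \<in> binary_tests d \<Longrightarrow>
    linear_classifier d b w x = (if (\<Sum>i<d. w i * x i) > b then 1 else 0)"
  by (simp add: linear_classifier_def)

lemma binary_tests_range: "x \<in> binary_tests d \<Longrightarrow> j < d \<Longrightarrow> x j = 0 \<or> x j = 1"
  unfolding binary_tests_def by (metis PiE_mem insertE lessThan_iff singletonD)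

lemma ternary_weights_range:
  "w \<in> ternary_weights d \<Longrightarrow> j < d \<Longrightarrow> w j = -1 \<or> w j = 0 \<or> w j = 1"
  unfolding ternary_weights_def by (metis PiE_mem insertE lessThan_iff singletonD)

definition flip :: "(nat \<Rightarrow> int) \<Rightarrow> nat set \<Rightarrow> nat \<Rightarrow> int" where
  "flip x S j = (if j \<in> S then 1 - x j else x j)"

lemma flip_mem:
  assumes "x \<in> binary_tests d" "S \<subseteq> {..<d}"
  shows "flip x S \<in> binary_tests d"
  using assms unfolding binary_tests_def
  by (force simp: flip_def PiE_iff extensional_def)

text \<open>The change of w . x when coordinate \<open>j\<close> is flipped, since
  \<open>x j\<close> changes by \<open>1 - 2 * x j\<close>.\<close>

definition flip_gain :: "nat \<Rightarrow> (nat \<Rightarrow> int) \<Rightarrow> (nat \<Rightarrow> int) \<Rightarrow> nat \<Rightarrow> int" where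
  "flip_gain d x w = (\<lambda>j\<in>{..<d}. (1 - 2 * x j) * w j)"

lemma sum_flip:
  assumes "S \<subseteq> {..<d}"
  shows "(\<Sum>j<d. w j * flip x S j) = (\<Sum>j<d. w j * x j) + sum (flip_gain d x w) S"
proof -
  have "sum (flip_gain d x w) S = (\<Sum>j<d. if j \<in> S then flip_gain d x w j else 0)"
    using assms by (simp add: sum.inter_restrict[symmetric] Int_absorb1)
  then show ?thesis
    unfolding sum.distrib[symmetric]
    by (auto simp: flip_def flip_gain_def algebra_simps simp flip: sum.distrib intro!: sum.cong)
qed

lemma flip_gain_mem:
  assumes x: "x \<in> binary_tests d" and w: "w \<in> ternary_weights d"
  shows "flip_gain d x w \<in> {..<d} \<rightarrow>\<^sub>E {-1, 0, 1}"
proof (rule PiE_I)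
  fix j assume "j \<in> {..<d}"
  then show "flip_gain d x w j \<in> {-1, 0, 1}"
    using binary_tests_range[OF x, of j] ternary_weights_range[OF w, of j]
    by (auto simp: flip_gain_def)
qed (simp add: flip_gain_def)

lemma flip_gain_inj:
  assumes x: "x \<in> binary_tests d" and w: "w \<in> ternary_weights d" "w' \<in> ternary_weights d"
    and eq: "flip_gain d x w = flip_gain d x w'"
  shows "w = w'"
proof (rule extensionalityI[of _ "{..<d}"])
  show "w \<in> extensional {..<d}" "w' \<in> extensional {..<d}"
    using w by (auto simp: ternary_weights_def PiE_def)
  fix j assume "j \<in> {..<d}"
  then have "(1 - 2 * x j) * w j = (1 - 2 * x j) * w' j"
    using fun_cong[OF eq, of j] by (simp add: flip_gain_def)
  then show "w j = w' j"
    using binary_tests_range[OF x, of j] \<open>j \<in> {..<d}\<close> by auto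
qed

text \<open>Flipping reverses the sign of exactly the weights at coordinates with
  \<open>x j = 1\<close>. For w . x = b, the right-hand sides become the two quantities that the
  balance hypotheses compare.\<close>

lemma num_flip_gain:
  assumes x: "x \<in> binary_tests d" and w: "w \<in> ternary_weights d"
  shows "int (card {j \<in> {..<d}. flip_gain d x w j > 0}) =
      int (num_pos d w) - (\<Sum>j<d. w j * x j)"
    and "int (card {j \<in> {..<d}. flip_gain d x w j < 0}) =
      int (num_neg d w) + (\<Sum>j<d. w j * x j)"
proof -
  have card: "int (card {j \<in> {..<d}. Q j}) = (\<Sum>j<d. of_bool (Q j))" for Q
    by (simp add: Int_def)
  show "int (card {j \<in> {..<d}. flip_gain d x w j > 0}) =
      int (num_pos d w) - (\<Sum>j<d. w j * x j)"
    unfolding num_pos_def card sum_subtractf[symmetric]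
  proof (rule sum.cong)
    fix j assume "j \<in> {..<d}"
    then show "of_bool (flip_gain d x w j > 0) = of_bool (w j > 0) - w j * x j"
      using binary_tests_range[OF x, of j] ternary_weights_range[OF w, of j]
      by (auto simp: flip_gain_def)
  qed simp
  show "int (card {j \<in> {..<d}. flip_gain d x w j < 0}) =
      int (num_neg d w) + (\<Sum>j<d. w j * x j)"
    unfolding num_neg_def card sum.distrib[symmetric]
  proof (rule sum.cong)
    fix j assume "j \<in> {..<d}"
    then show "of_bool (flip_gain d x w j < 0) = of_bool (w j < 0) + w j * x j"
      using binary_tests_range[OF x, of j] ternary_weights_range[OF w, of j]
      by (auto simp: flip_gain_def)
  qed simp
qed

text \<open>Correct the coordinates in which two tests differ one by one; every single flip is an
  arc.\<close>

lemma strongly_connected_cube: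
  assumes verts: "pverts G = binary_tests d"
    and arcs: "\<And>x i. x \<in> binary_tests d \<Longrightarrow> i < d \<Longrightarrow> (x, flip x {i}) \<in> parcs G"
  shows "strongly_connected (with_proj G)"
proof (rule strongly_connectedI)
  have "(\<lambda>j\<in>{..<d}. 0) \<in> binary_tests d" by (simp add: binary_tests_def)
  then show "verts (with_proj G) \<noteq> {}" using verts by auto
next
  fix v u assume "v \<in> verts (with_proj G)" "u \<in> verts (with_proj G)"
  then have v: "v \<in> binary_tests d" and u: "u \<in> binary_tests d" using verts by auto
  have flip_path: "S \<subseteq> {..<d} \<Longrightarrow> (flip u S, u) \<in> rtrancl_on (binary_tests d) (parcs G)"
    if "finite S" for S
    using that
  proof (induction S rule: finite_induct)
    case empty
    have "flip u {} = u" by (simp add: flip_def fun_eq_iff)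
    then show ?case using u by simp
  next
    case (insert i S)
    have "flip (flip u (insert i S)) {i} = flip u S"
      using insert.hyps by (auto simp: flip_def fun_eq_iff)
    then have "(flip u (insert i S), flip u S) \<in> parcs G"
      using arcs[OF flip_mem[OF u], of "insert i S" i] insert.prems by auto
    then show ?case
      using insert flip_mem[OF u, of "insert i S"]
      by (auto intro: converse_rtrancl_on_into_rtrancl_on)
  qed
  have "v j = flip u {j \<in> {..<d}. v j \<noteq> u j} j" for j
    using binary_tests_range[OF u, of j] binary_tests_range[OF v, of j] u v
    by (cases "j < d") (auto simp: flip_def binary_tests_def PiE_def extensional_def)
  then have "v = flip u {j \<in> {..<d}. v j \<noteq> u j}" by blast
  then have "(v, u) \<in> rtrancl_on (binary_tests d) (parcs G)"
    using flip_path[of "{j \<in> {..<d}. v j \<noteq> u j}"] by auto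
  then show "v \<rightarrow>\<^sup>*\<^bsub>with_proj G\<^esub> u"
    using verts by (simp add: reachable_def)
qed

section \<open>Adjacent tests and the theorem\<close>

lemma mean_reindex:
  assumes "inj_on f V"
  shows "mean V (\<lambda>h. g (f h)) = mean (f ` V) g"
  using assms by (simp add: mean_def card_image sum.reindex)

lemma adjacent_tests_split:
  fixes r \<alpha> :: real
  assumes r: "r > 0" and \<alpha>: "0 < \<alpha>" "\<alpha> \<le> 1/16" "8 * r * \<alpha> \<le> 1"
    and H: "H \<subseteq> {linear_classifier d b w | b w.
      w \<in> ternary_weights d \<and>
      real (num_pos d w) - real_of_int b \<le>
        r * (real (num_neg d w) + real_of_int b) - real d / 8 \<and>
      real (num_neg d w) + real_of_int b \<le>
        r * (real (num_pos d w) - real_of_int b - 1) - real d / 8}"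
    and x: "x \<in> binary_tests d" and i: "i < d"
    and V: "V \<subseteq> Delta H x (flip x {i})" "card V \<ge> 2"
  obtains y where "y \<in> binary_tests d" "mean V (\<lambda>h. real (h y)) \<in> {\<alpha>..1 - \<alpha>}"
proof -
  have "\<exists>b w. h = linear_classifier d b w \<and> w \<in> ternary_weights d \<and>
      real (num_pos d w) - real_of_int b \<le>
        r * (real (num_neg d w) + real_of_int b) - real d / 8 \<and>
      real (num_neg d w) + real_of_int b \<le>
        r * (real (num_pos d w) - real_of_int b - 1) - real d / 8" if "h \<in> V" for h
    using that V(1) H by (force simp: Delta_def)
  then obtain b w where h: "\<And>h. h \<in> V \<Longrightarrow> h = linear_classifier d (b h) (w h)"
    and w: "\<And>h. h \<in> V \<Longrightarrow> w h \<in> ternary_weights d"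
    and bal: "\<And>h. h \<in> V \<Longrightarrow> real (num_pos d (w h)) - real_of_int (b h) \<le>
        r * (real (num_neg d (w h)) + real_of_int (b h)) - real d / 8"
      "\<And>h. h \<in> V \<Longrightarrow> real (num_neg d (w h)) + real_of_int (b h) \<le>
        r * (real (num_pos d (w h)) - real_of_int (b h) - 1) - real d / 8"
    by metis
  define a where "a h = flip_gain d x (w h)" for h
  have a_mem: "a h \<in> {..<d} \<rightarrow>\<^sub>E {-1, 0, 1}" if "h \<in> V" for h
    unfolding a_def using flip_gain_mem[OF x w[OF that]] .
  \<comment> \<open>w . x \<le> b < w . x + \<open>a h i\<close> with integers and a gain of at most
    1 leaves only equality and gain 1.\<close>
  have boundary: "(\<Sum>j<d. w h j * x j) = b h" "a h i = 1" if hV: "h \<in> V" for h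
  proof -
    have "h x = 0" "h (flip x {i}) = 1" using V(1) hV by (auto simp: Delta_def)
    moreover have "flip x {i} \<in> binary_tests d" using x i by (intro flip_mem) auto
    moreover have "(\<Sum>j<d. w h j * flip x {i} j) = (\<Sum>j<d. w h j * x j) + a h i"
      using sum_flip[of "{i}" d "w h" x] i by (simp add: a_def)
    ultimately have "(\<Sum>j<d. w h j * x j) \<le> b h" "(\<Sum>j<d. w h j * x j) + a h i > b h"
      using h[OF hV] linear_classifier_at[OF x, of "b h" "w h"]
        linear_classifier_at[of "flip x {i}" d "b h" "w h"]
      by (auto split: if_splits)
    moreover have "a h i \<in> {-1, 0, 1}" using a_mem[OF hV] i by (auto dest: PiE_mem)
    ultimately show "(\<Sum>j<d. w h j * x j) = b h" "a h i = 1" by auto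
  qed
  \<comment> \<open>The gains determine the weights, and the weights determine the threshold as w .
    x, so distinct hypotheses have distinct gain vectors.\<close>
  have inj: "inj_on a V"
  proof (rule inj_onI)
    fix h h' assume "h \<in> V" "h' \<in> V" "a h = a h'"
    then have "w h = w h'" using flip_gain_inj[OF x] w by (simp add: a_def)
    then show "h = h'" using h boundary(1) \<open>h \<in> V\<close> \<open>h' \<in> V\<close> by metis
  qed
  have flip_value: "real (h (flip x S)) = of_bool (sum (a h) S > 0)" if "h \<in> V" "S \<subseteq> {..<d}" for h S
    using h[OF that(1)] linear_classifier_at[OF flip_mem[OF x that(2)], of "b h" "w h"]
      sum_flip[OF that(2), of "w h" x] boundary(1)[OF that(1)]
    by (simp add: a_def)
  have num: "real (card {j \<in> {..<d}. a h j > 0}) = real (num_pos d (w h)) - real_of_int (b h)"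
    "real (card {j \<in> {..<d}. a h j < 0}) = real (num_neg d (w h)) + real_of_int (b h)" if "h \<in> V" for h
    using num_flip_gain[OF x w[OF that]] boundary(1)[OF that] unfolding a_def by linarith+
  obtain S where S: "S \<subseteq> {..<d}"
    "(\<Sum>c\<in>a ` V. of_bool (sum c S > 0)) / real (card (a ` V)) \<in> {\<alpha>..1 - \<alpha>}"
  proof (rule exists_balanced_split[of "{..<d}" "a ` V" i \<alpha> r])
    show "a ` V \<subseteq> {..<d} \<rightarrow>\<^sub>E {-1, 0, 1}" using a_mem by blast
    show "card (a ` V) \<ge> 2" using V(2) inj by (simp add: card_image)
    show "c i = 1" if "c \<in> a ` V" for c using that boundary(2) by auto
    show "real (card {j \<in> {..<d}. c j > 0}) \<le>
        r * real (card {j \<in> {..<d}. c j < 0}) - real (card {..<d}) / 8" if "c \<in> a ` V" for c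
    proof -
      from that obtain h where "h \<in> V" "c = a h" by blast
      then show ?thesis using bal(1)[of h] num[of h] by (simp del: Collect_conj_eq)
    qed
    show "real (card {j \<in> {..<d}. c j < 0}) \<le>
        r * (real (card {j \<in> {..<d}. c j > 0}) - 1) - real (card {..<d}) / 8" if "c \<in> a ` V" for c
    proof -
      from that obtain h where "h \<in> V" "c = a h" by blast
      then show ?thesis using bal(2)[of h] num[of h] by (simp del: Collect_conj_eq)
    qed
  qed (use r \<alpha> i in auto)
  show thesis
  proof
    show "flip x S \<in> binary_tests d" using x S(1) by (rule flip_mem)
    have "mean V (\<lambda>h. real (h (flip x S))) = mean V (\<lambda>h. of_bool (sum (a h) S > 0))"
      unfolding mean_def using flip_value S(1) by (simp cong: sum.cong)
    also have "\<dots> = mean (a ` V) (\<lambda>c. of_bool (sum c S > 0))"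
      by (rule mean_reindex[OF inj])
    finally show "mean V (\<lambda>h. real (h (flip x S))) \<in> {\<alpha>..1 - \<alpha>}"
      using S(2) by (simp only: mean_def)
  qed
qed

theorem theorem4p5:
  fixes d :: nat and r :: real and H :: "((nat \<Rightarrow> int) \<Rightarrow> nat) set"
  assumes "d \<ge> 1" and "r > 0"
    and "H \<subseteq> {linear_classifier d b w | b w.
      w \<in> ternary_weights d \<and>
      real (num_pos d w) - real_of_int b \<le>
        r * (real (num_neg d w) + real_of_int b) - real d / 8 \<and>
      real (num_neg d w) + real_of_int b \<le>
        r * (real (num_pos d w) - real_of_int b - 1) - real d / 8}"
  shows "split_neighborly (max 16 (8 * r)) H (binary_tests d)"
proof -
  \<comment> \<open>The two entries of the maximum provide \<alpha> \<le> 1/16 and 8 r \<alpha>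
    \<le> 1 respectively.\<close>
  define \<alpha> where "\<alpha> = 1 / max 16 (8 * r)"
  have \<alpha>: "0 < \<alpha>" "\<alpha> \<le> 1/16" "8 * r * \<alpha> \<le> 1"
    by (auto simp: \<alpha>_def divide_simps)
  have "strongly_connected (with_proj (split_graph \<alpha> H (binary_tests d)))"
  proof (rule strongly_connected_cube)
    show "pverts (split_graph \<alpha> H (binary_tests d)) = binary_tests d"
      by (simp add: split_graph_def)
    fix x i assume x: "x \<in> binary_tests d" and i: "i < d"
    \<comment> \<open>An infinite \<open>V\<close> has \<open>card V = 0\<close> and falls under the
      first alternative.\<close>
    have "\<exists>y\<in>binary_tests d. mean V (\<lambda>h. real (h y)) \<in> {\<alpha>..1 - \<alpha>}"
      if "V \<subseteq> Delta H x (flip x {i})" "\<not> card V \<le> 1" for V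
      using adjacent_tests_split[OF assms(2) \<alpha> assms(3) x i that(1)] that(2) by fastforce
    then show "(x, flip x {i}) \<in> parcs (split_graph \<alpha> H (binary_tests d))"
      using x flip_mem[OF x, of "{i}"] i by (auto simp: split_graph_def simp del: atLeastAtMost_iff)
  qed
  moreover have "max 16 (8 * r) = 1 / \<alpha>" by (simp add: \<alpha>_def)
  ultimately show ?thesis
    using \<alpha> unfolding split_neighborly_def by (intro bexI[of _ \<alpha>]) auto
qed

end
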